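(* Let $w_1,w_2,w_3$ be any odd positive integers, let $y_1,y_2\in\mathbb{Z}_p$, and let $n\ge 0$ be an integer. Then the following six expressions are all equal: \begin{align*} &\sum_{k+l+m=n}\binom{n}{k,l,m}E_{k,\chi,\xi^{w_2w_3}}(w_1y_1)E_{l,\chi,\xi^{w_1w_3}}(w_2y_2)T_m(w_3d-1;\chi,\xi^{w_1w_2})\,w_{1}^{l+m}w_{2}^{k+m}w_{3}^{k+l}\\ =&\sum_{k+l+m=n}\binom{n}{k,l,m}E_{k,\chi,\xi^{w_2w_3}}(w_1y_1)E_{l,\chi,\xi^{w_1w_2}}(w_3y_2)T_m(w_2d-1;\chi,\xi^{w_1w_3})\,w_{1}^{l+m}w_{3}^{k+m}w_{2}^{k+l}\\ =&\sum_{k+l+m=n}\binom{n}{k,l,m}E_{k,\chi,\xi^{w_1w_3}}(w_2y_1)E_{l,\chi,\xi^{w_2w_3}}(w_1y_2)T_m(w_3d-1;\chi,\xi^{w_1w_2})\,w_{2}^{l+m}w_{1}^{k+m}w_{3}^{k+l}\\ =&\sum_{k+l+m=n}\binom{n}{k,l,m}E_{k,\chi,\xi^{w_1w_3}}(w_2y_1)E_{l,\chi,\xi^{w_1w_2}}(w_3y_2)T_m(w_1d-1;\chi,\xi^{w_2w_3})\,w_{2}^{l+m}w_{3}^{k+m}w_{1}^{k+l}\\ =&\sum_{k+l+m=n}\binom{n}{k,l,m}E_{k,\chi,\xi^{w_1w_2}}(w_3y_1)E_{l,\chi,\xi^{w_1w_3}}(w_2y_2)T_m(w_1d-1;\chi,\xi^{w_2w_3})\,w_{3}^{l+m}w_{2}^{k+m}w_{1}^{k+l}\\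 =&\sum_{k+l+m=n}\binom{n}{k,l,m}E_{k,\chi,\xi^{w_1w_2}}(w_3y_1)E_{l,\chi,\xi^{w_2w_3}}(w_1y_2)T_m(w_2d-1;\chi,\xi^{w_1w_3})\,w_{3}^{l+m}w_{1}^{k+m}w_{2}^{k+l}. \end{align*}
   Context: Let $p$ be a fixed odd prime, $\mathbb{Z}_p$ the $p$-adic integers, $\mathbb{C}_p$ the completion of an algebraic closure of $\mathbb{Q}_p$. Let $\xi\in\mathbb{C}_p$ be a fixed ramified root of unity, i.e. $\xi^{p^s}=1$ for some positive integer $s$. Let $d$ be a fixed odd positive integer and $\chi$ a primitive Dirichlet character of conductor $d$, regarded as a function on the integers (periodic mod $d$, zero on integers not coprime to $d$) with values in $\mathbb{C}_p$ via a fixed embedding $\overline{\mathbb{Q}}\to\mathbb{C}_p$. For a ramified root of unity $\zeta$ (e.g. $\zeta=\xi^{w}$), the generalized twisted Euler polynomials $E_{n,\chi,\zeta}(x)$ are the polynomials in $x$ defined by $$\frac{2e^{xt}}{\zeta^d e^{dt}+1}\sum_{a=0}^{d-1}(-1)^a\chi(a)\zeta^a e^{at}=\sum_{n=0}^{\infty}E_{n,\chi,\zeta}(x)\frac{t^n}{n!}.$$ The alternating generalized twisted power sum is $T_k(N;\chi,\zeta)=\sum_{a=0}^{N}(-1)^a\chi(a)\zeta^a a^k$ (with $0^0=1$). The sums are over nonnegative integers $k,l,m$ with $k+l+m=n$, and $\binom{n}{k,l,m}=\frac{n!}{k!\,l!\,m!}$. *)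

theory Defs
  imports "HOL-Analysis.Analysis" "HOL-Number_Theory.Cong"
begin

section \<open>The field of complex \<open>p\<close>-adic numbers\<close>

text \<open>
  The absolute value of a \<open>p\<close>-adic field is written \<^term>\<open>dist x 0\<close>: the norm classes of the
  library are built on real vector spaces and do not apply here.
\<close>

definition padic_rats :: "'a::{field_char_0, metric_space} set" where
  "padic_rats = closure \<rat>"

definition padic_ints :: "'a::{field_char_0, metric_space} set" where
  "padic_ints = {x \<in> padic_rats. dist x 0 \<le> 1}"

definition padic_algebraics :: "'a::{field_char_0, metric_space} set" where
  "padic_algebraics = {x. \<exists>f. f \<noteq> 0 \<and> (\<forall>i. coeff f i \<in> padic_rats) \<and> poly f x = 0}"

text \<open>
  There is no type of complex \<open>p\<close>-adic numbers in the library, so we describe the complete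
  metric fields that are one. By \<open>dist_p\<close> and the ultrametric inequality the metric restricts to
  the \<open>p\<close>-adic one on \<^term>\<open>\<rat>\<close>; by completeness \<^const>\<open>padic_rats\<close> is then a copy of the
  field of \<open>p\<close>-adic numbers. The last two axioms say that \<^const>\<open>padic_algebraics\<close> is an
  algebraic closure of it and that the whole field is the completion of that algebraic closure.
  These axioms determine the field up to isometric isomorphism.
\<close>

locale complex_padic_field =
  fixes p :: nat
  assumes prime_p: "prime p"
    and dist_translate: "dist x y = dist (x - y) (0::'a::{field_char_0, complete_space})"
    and dist_mult: "dist (x * y) (0::'a) = dist x 0 * dist y 0"
    and dist_ultrametric: "dist (x + y) (0::'a) \<le> max (dist x 0) (dist y 0)"
    and dist_p: "dist (of_nat p) (0::'a) = 1 / real p"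
    and padic_algebraics_closed:
      "degree f > 0 \<Longrightarrow> (\<And>i. coeff f i \<in> (padic_algebraics :: 'a set)) \<Longrightarrow>
       \<exists>x \<in> padic_algebraics. poly f x = 0"
    and padic_algebraics_dense: "closure (padic_algebraics :: 'a set) = UNIV"

text \<open>
  An embedding of the algebraic numbers, which we take inside \<^typ>\<open>complex\<close>. The values at
  transcendental arguments are irrelevant.
\<close>

definition algebraic_embedding :: "(complex \<Rightarrow> 'a::field_char_0) \<Rightarrow> bool" where
  "algebraic_embedding \<iota> \<longleftrightarrow> \<iota> 1 = 1 \<and>
     (\<forall>x y. algebraic x \<longrightarrow> algebraic y \<longrightarrow>
        \<iota> (x + y) = \<iota> x + \<iota> y \<and> \<iota> (x * y) = \<iota> x * \<iota> y)"

section \<open>Dirichlet characters\<close>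

definition dirichlet_character :: "nat \<Rightarrow> (int \<Rightarrow> complex) \<Rightarrow> bool" where
  "dirichlet_character d chi \<longleftrightarrow> d > 0 \<and>
     (\<forall>a b. chi (a * b) = chi a * chi b) \<and>
     (\<forall>a. chi (a + int d) = chi a) \<and>
     (\<forall>a. chi a \<noteq> 0 \<longleftrightarrow> coprime a (int d))"

definition conductor :: "nat \<Rightarrow> (int \<Rightarrow> complex) \<Rightarrow> nat" where
  "conductor d chi = (LEAST f. f > 0 \<and> f dvd d \<and>
     (\<forall>a. coprime a (int d) \<and> [a = 1] (mod int f) \<longrightarrow> chi a = 1))"

definition primitive_character :: "nat \<Rightarrow> (int \<Rightarrow> complex) \<Rightarrow> bool" where
  "primitive_character d chi \<longleftrightarrow> dirichlet_character d chi \<and> conductor d chi = d"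

section \<open>Generalized twisted Euler polynomials and alternating power sums\<close>

definition euler_gf :: "nat \<Rightarrow> (int \<Rightarrow> 'a::field_char_0) \<Rightarrow> 'a \<Rightarrow> 'a fps" where
  "euler_gf d chi \<zeta> =
     2 / (fps_const (\<zeta> ^ d) * fps_exp (of_nat d) + 1) *
     (\<Sum>a<d. fps_const ((-1) ^ a * chi (int a) * \<zeta> ^ a) * fps_exp (of_nat a))"

text \<open>
  The first factor is \<open>e\<^sup>x\<^sup>t\<close> as a power series in \<open>t\<close> whose coefficients are polynomials in \<open>x\<close>;
  the second one is \<^const>\<open>euler_gf\<close> with its coefficients read as constant polynomials.
\<close>

definition gen_euler_poly :: "nat \<Rightarrow> (int \<Rightarrow> 'a::field_char_0) \<Rightarrow> 'a \<Rightarrow> nat \<Rightarrow> 'a poly" where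
  "gen_euler_poly d chi \<zeta> n = smult (fact n)
     (fps_nth (Abs_fps (\<lambda>i. monom (1 / fact i) i) *
               Abs_fps (\<lambda>i. [:fps_nth (euler_gf d chi \<zeta>) i:])) n)"

lemma gen_euler_poly_gf:
  fixes \<zeta> x :: "'a::field_char_0"
  assumes "\<zeta> ^ d + 1 \<noteq> 0"
  shows "Abs_fps (\<lambda>n. poly (gen_euler_poly d chi \<zeta> n) x / fact n) =
     2 * fps_exp x / (fps_const (\<zeta> ^ d) * fps_exp (of_nat d) + 1) *
     (\<Sum>a<d. fps_const ((-1) ^ a * chi (int a) * \<zeta> ^ a) * fps_exp (of_nat a))"
proof -
  let ?D = "fps_const (\<zeta> ^ d) * fps_exp (of_nat d) + 1"
  have D: "fps_nth ?D 0 \<noteq> 0"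
    using assms by simp
  have "Abs_fps (\<lambda>n. poly (gen_euler_poly d chi \<zeta> n) x / fact n) = fps_exp x * euler_gf d chi \<zeta>"
    by (rule fps_ext)
      (simp add: gen_euler_poly_def fps_mult_nth poly_sum poly_monom mult_ac)
  then show ?thesis
    unfolding euler_gf_def fps_divide_unit[OF D] by (simp only: mult_ac)
qed

lemma ramified_root_of_unity_power:
  fixes \<zeta> :: "'a::field_char_0"
  assumes "\<zeta> ^ (p ^ s) = 1" "odd p" "odd d"
  shows "\<zeta> ^ d + 1 \<noteq> 0"
proof
  assume "\<zeta> ^ d + 1 = 0"
  then have "\<zeta> ^ d = -1"
    by (simp add: eq_neg_iff_add_eq_0)
  then have "(\<zeta> ^ (p ^ s)) ^ d = (-1) ^ (p ^ s)"
    by (metis power_mult mult.commute)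
  with assms show False
    by simp
qed

definition alt_power_sum :: "nat \<Rightarrow> nat \<Rightarrow> (int \<Rightarrow> 'a::field_char_0) \<Rightarrow> 'a \<Rightarrow> 'a" where
  "alt_power_sum k N chi \<zeta> = (\<Sum>a\<le>N. (-1) ^ a * chi (int a) * \<zeta> ^ a * of_nat a ^ k)"

definition trinomial :: "nat \<Rightarrow> nat \<Rightarrow> nat \<Rightarrow> nat \<Rightarrow> 'a::field_char_0" where
  "trinomial n k l m = fact n / (fact k * fact l * fact m)"

definition euler_power_sum ::
  "nat \<Rightarrow> (int \<Rightarrow> 'a::field_char_0) \<Rightarrow> 'a \<Rightarrow> 'a \<Rightarrow> 'a \<Rightarrow> nat \<Rightarrow> nat \<Rightarrow> nat \<Rightarrow> nat \<Rightarrow> 'a" where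
  "euler_power_sum d chi \<xi> y\<^sub>1 y\<^sub>2 n u v w =
     (\<Sum>(k, l, m) \<in> {(k, l, m). k + l + m = n}.
        trinomial n k l m *
        poly (gen_euler_poly d chi (\<xi> ^ (v * w)) k) (of_nat u * y\<^sub>1) *
        poly (gen_euler_poly d chi (\<xi> ^ (u * w)) l) (of_nat v * y\<^sub>2) *
        alt_power_sum m (w * d - 1) chi (\<xi> ^ (u * v)) *
        of_nat u ^ (l + m) * of_nat v ^ (k + m) * of_nat w ^ (k + l))"

end

theory Submission
  imports Defs
begin

text \<open>
  Write \<open>G(\<zeta>, t)\<close> for the generating function of \<open>E\<^sub>n\<^sub>,\<^sub>\<chi>\<^sub>,\<^sub>\<zeta>(0)\<close>. Since \<open>\<chi>\<close> has period \<open>d\<close> and \<open>w\<close>, \<open>d\<close> are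
  odd, summing a geometric series gives \<open>1/2 G(\<zeta>, t) (1 + \<zeta>\<^sup>w\<^sup>d exp (w d t))\<close> as the exponential
  generating function of the power sums \<open>T\<^sub>m(w d - 1; \<chi>, \<zeta>)\<close>. Consequently, with \<open>W = w\<^sub>1 w\<^sub>2 w\<^sub>3\<close>, each
  of the six expressions is \<open>n!\<close> times the \<open>n\<close>-th coefficient of the product of
  \<open>1/2 exp (W (y\<^sub>1 + y\<^sub>2) t) (1 + \<xi>\<^sup>W\<^sup>d exp (W d t))\<close> and the three series \<open>G(\<xi>\<^sup>m, m t)\<close> for
  \<open>m = w\<^sub>2 w\<^sub>3, w\<^sub>1 w\<^sub>3, w\<^sub>1 w\<^sub>2\<close>, which is symmetric in \<open>w\<^sub>1, w\<^sub>2, w\<^sub>3\<close>.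
\<close>

text \<open>Cut into \<open>w\<close> blocks of length \<open>d\<close>, the long sum has each block
  equal to \<open>z ^ d\<close> times the previous one, so multiplying by \<open>1 - z ^ d\<close>
  telescopes. The product form avoids division.\<close>

lemma sum_periodic_power_series:
  fixes z :: "'a::comm_ring_1"
  assumes "\<And>i. f (i + d) = f i"
  shows "(\<Sum>a<w * d. f a * z ^ a) * (1 - z ^ d) = (\<Sum>a<d. f a * z ^ a) * (1 - z ^ (w * d))"
proof (induction w)
  case (Suc w)
  have per: "f (i + w * d) = f i" for i
    by (induction w) (simp_all add: assms add.commute[of d] flip: add.assoc)
  have "(\<Sum>a<Suc w * d. f a * z ^ a)
      = (\<Sum>a<w * d. f a * z ^ a) + (\<Sum>a<d. f (a + w * d) * z ^ (a + w * d))"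
    using sum.nat_group[of "\<lambda>a. f a * z ^ a" d "Suc w"] sum.nat_group[of "\<lambda>a. f a * z ^ a" d w]
      sum.shift_bounds_nat_ivl[of "\<lambda>a. f a * z ^ a" 0 "w * d" d]
    by (simp add: add.commute atLeast0LessThan)
  also have "\<dots> = (\<Sum>a<w * d. f a * z ^ a) + (\<Sum>a<d. f a * z ^ a) * z ^ (w * d)"
    by (simp add: per power_add sum_distrib_right mult.assoc)
  finally show ?case
    by (simp only: distrib_right Suc) (simp add: algebra_simps power_add)
qed simp

lemma fps_mult_mult_nth:
  fixes f g h :: "'a::comm_ring_1 fps"
  shows "fps_nth (f * g * h) n
    = (\<Sum>(k, l, m) \<in> {(k, l, m). k + l + m = n}. fps_nth f k * fps_nth g l * fps_nth h m)"
proof -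
  have "fps_nth (f * g * h) n
      = (\<Sum>i\<le>n. \<Sum>k\<le>i. fps_nth f k * fps_nth g (i - k) * fps_nth h (n - i))"
    by (simp add: fps_mult_nth sum_distrib_right atLeast0AtMost)
  also have "\<dots> = (\<Sum>(i, k) \<in> Sigma {..n} (\<lambda>i. {..i}).
      fps_nth f k * fps_nth g (i - k) * fps_nth h (n - i))"
    by (subst sum.Sigma) auto
  also have "\<dots> = (\<Sum>(k, l, m) \<in> {(k, l, m). k + l + m = n}.
      fps_nth f k * fps_nth g l * fps_nth h m)"
    by (rule sum.reindex_bij_witness[where i = "\<lambda>(k, l, m). (k + l, k)"
          and j = "\<lambda>(i, k). (k, i - k, n - i)"]) auto
  finally show ?thesis .
qed

lemma poly_gen_euler_poly:
  "poly (gen_euler_poly d chi \<zeta> n) x = fact n * fps_nth (fps_exp x * euler_gf d chi \<zeta>) n"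
  by (simp add: gen_euler_poly_def fps_mult_nth poly_sum poly_monom mult_ac)

text \<open>Sign, twist and exponential merge into powers of one series, so that the sums over
  \<open>a\<close> become geometric-type sums.\<close>

lemma fps_twist_power:
  fixes \<zeta> c :: "'a::field_char_0"
  shows "(fps_const (- \<zeta>) * fps_exp c) ^ a
    = fps_const ((-1) ^ a * \<zeta> ^ a) * fps_exp (of_nat a * c)"
  by (simp add: power_mult_distrib fps_exp_power_mult power_minus[of \<zeta>])

lemma alt_power_sum_gf:
  fixes \<zeta> c :: "'a::field_char_0"
  assumes "N > 0"
  shows "alt_power_sum m (N - 1) chi \<zeta> * c ^ m
    = fact m * fps_nth (\<Sum>a<N. fps_const (chi (int a)) * (fps_const (- \<zeta>) * fps_exp c) ^ a) m"
proof -
  \<comment> \<open>Natural subtraction truncates: for \<open>N = 0\<close> the left side would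
    still contain 0.\<close>
  have "{..N - 1} = {..<N}"
    using assms by auto
  then show ?thesis
    unfolding fps_twist_power
    by (simp add: alt_power_sum_def fps_sum_nth sum_distrib_left sum_distrib_right
        power_mult_distrib mult_ac)
qed

text \<open>The defining fraction with its denominator cleared, after substituting
  \<open>c * t\<close> for \<open>t\<close>. As \<open>d\<close> is odd, the denominator
  \<open>1 + \<zeta> ^ d * exp (d * c * t)\<close> is \<open>1 - z ^ d\<close> for
  \<open>z = - \<zeta> * exp (c * t)\<close>.\<close>

lemma euler_gf_scaled:
  fixes \<zeta> c :: "'a::field_char_0"
  assumes "\<zeta> ^ d + 1 \<noteq> 0" "odd d"
  shows "(euler_gf d chi \<zeta> oo (fps_const c * fps_X)) * (1 - (fps_const (- \<zeta>) * fps_exp c) ^ d)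
    = 2 * (\<Sum>a<d. fps_const (chi (int a)) * (fps_const (- \<zeta>) * fps_exp c) ^ a)"
proof -
  let ?D = "fps_const (\<zeta> ^ d) * fps_exp (of_nat d) + 1"
  let ?P = "\<Sum>a<d. fps_const ((-1) ^ a * chi (int a) * \<zeta> ^ a) * fps_exp (of_nat a)"
  let ?s = "fps_const c * fps_X"
  have s: "fps_nth ?s 0 = 0"
    by simp
  have D: "fps_nth ?D 0 \<noteq> 0"
    using assms by simp
  have "euler_gf d chi \<zeta> * ?D = 2 * ?P * (inverse ?D * ?D)"
    unfolding euler_gf_def fps_divide_unit[OF D] by (simp only: mult_ac)
  also have "\<dots> = fps_const 2 * ?P"
    using inverse_mult_eq_1[OF D] by (simp add: numeral_fps_const)
  finally have "euler_gf d chi \<zeta> * ?D = fps_const 2 * ?P" .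
  then have "(euler_gf d chi \<zeta> * ?D) oo ?s = (fps_const 2 * ?P) oo ?s"
    by (rule arg_cong)
  then have "(euler_gf d chi \<zeta> oo ?s) * (?D oo ?s) = fps_const 2 * (?P oo ?s)"
    by (simp only: fps_compose_mult_distrib[OF s] fps_const_compose)
  moreover have "?D oo ?s = 1 - (fps_const (- \<zeta>) * fps_exp c) ^ d"
    using \<open>odd d\<close> unfolding fps_twist_power
    by (simp add: fps_compose_add_distrib fps_compose_mult_distrib[OF s] fps_const_neg[symmetric] mult.commute[of c]
        del: fps_const_neg)
  moreover have "?P oo ?s = (\<Sum>a<d. fps_const (chi (int a)) * (fps_const (- \<zeta>) * fps_exp c) ^ a)"
    unfolding fps_twist_power
    by (simp add: fps_compose_sum_distrib fps_compose_mult_distrib[OF s])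
      (simp add: fps_const_mult[symmetric] mult_ac del: fps_const_mult)
  ultimately show ?thesis
    by (simp add: numeral_fps_const)
qed

lemma euler_power_sum_gf:
  fixes \<xi> :: "'a::field_char_0" and chi :: "int \<Rightarrow> 'a" and d :: nat
  defines "G \<equiv> \<lambda>m. euler_gf d chi (\<xi> ^ m) oo (fps_const (of_nat m) * fps_X)"
  assumes root: "\<And>m. (\<xi> ^ m) ^ d + 1 \<noteq> 0"
    and per: "\<And>a. chi (a + int d) = chi a"
    and "odd d" "odd w"
  shows "2 * euler_power_sum d chi \<xi> y\<^sub>1 y\<^sub>2 n u v w
    = fact n * fps_nth (fps_exp (of_nat (u * v * w) * (y\<^sub>1 + y\<^sub>2)) * (G (v * w) * G (u * w) * G (u * v)) *
        (1 + fps_const (\<xi> ^ (u * v * w * d)) * fps_exp (of_nat (u * v * w * d)))) n"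
proof -
  let ?z = "fps_const (- (\<xi> ^ (u * v))) * fps_exp (of_nat (u * v))"
  let ?Q = "\<lambda>N. \<Sum>a<N. fps_const (chi (int a)) * ?z ^ a"
  let ?A = "(fps_exp (of_nat u * y\<^sub>1) * euler_gf d chi (\<xi> ^ (v * w))) oo (fps_const (of_nat (v * w)) * fps_X)"
  let ?B = "(fps_exp (of_nat v * y\<^sub>2) * euler_gf d chi (\<xi> ^ (u * w))) oo (fps_const (of_nat (u * w)) * fps_X)"
  let ?E = "1 + fps_const (\<xi> ^ (u * v * w * d)) * fps_exp (of_nat (u * v * w * d))"
  have pos: "w * d > 0"
    using \<open>odd d\<close> \<open>odd w\<close> by (auto elim: oddE)
  have "euler_power_sum d chi \<xi> y\<^sub>1 y\<^sub>2 n u v w = (\<Sum>(k, l, m) \<in> {(k, l, m). k + l + m = n}.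
      fact n * (fps_nth ?A k * fps_nth ?B l * fps_nth (?Q (w * d)) m))"
    unfolding euler_power_sum_def
  proof (intro sum.cong refl, clarify)
    fix k l m :: nat
    \<comment> \<open>The weights regroup as \<open>(v * w) ^ k * (u * w) ^ l * (u * v) ^ m\<close>,
      and each power is absorbed by rescaling \<open>t\<close> in the matching series.\<close>
    have "trinomial (k + l + m) k l m *
        poly (gen_euler_poly d chi (\<xi> ^ (v * w)) k) (of_nat u * y\<^sub>1) *
        poly (gen_euler_poly d chi (\<xi> ^ (u * w)) l) (of_nat v * y\<^sub>2) *
        alt_power_sum m (w * d - 1) chi (\<xi> ^ (u * v)) *
        of_nat u ^ (l + m) * of_nat v ^ (k + m) * of_nat w ^ (k + l)
      = trinomial (k + l + m) k l m * (fact k * fps_nth ?A k) * (fact l * fps_nth ?B l) *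
        (alt_power_sum m (w * d - 1) chi (\<xi> ^ (u * v)) * of_nat (u * v) ^ m)"
      unfolding poly_gen_euler_poly fps_nth_compose_linear
      by (simp only: of_nat_mult power_add power_mult_distrib mult_ac)
    also have "\<dots> = fact (k + l + m) * (fps_nth ?A k * fps_nth ?B l * fps_nth (?Q (w * d)) m)"
      unfolding alt_power_sum_gf[OF pos] by (simp add: trinomial_def)
    finally show "trinomial (k + l + m) k l m *
        poly (gen_euler_poly d chi (\<xi> ^ (v * w)) k) (of_nat u * y\<^sub>1) *
        poly (gen_euler_poly d chi (\<xi> ^ (u * w)) l) (of_nat v * y\<^sub>2) *
        alt_power_sum m (w * d - 1) chi (\<xi> ^ (u * v)) *
        of_nat u ^ (l + m) * of_nat v ^ (k + m) * of_nat w ^ (k + l)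
      = fact (k + l + m) * (fps_nth ?A k * fps_nth ?B l * fps_nth (?Q (w * d)) m)" .
  qed
  also have "\<dots> = fact n * fps_nth (?A * ?B * ?Q (w * d)) n"
    unfolding fps_mult_mult_nth by (simp add: sum_distrib_left case_prod_unfold)
  finally have S: "2 * euler_power_sum d chi \<xi> y\<^sub>1 y\<^sub>2 n u v w
      = fact n * fps_nth (?A * ?B * (2 * ?Q (w * d))) n"
    by (simp add: numeral_fps_const mult.left_commute[of _ "fps_const 2"] mult.left_commute)

  \<comment> \<open>The constant coefficient is \<open>1 + (\<xi> ^ (u * v)) ^ d\<close>, nonzero by
    \<open>root\<close>; this permits cancelling below.\<close>
  have nz: "1 - ?z ^ d \<noteq> 0"
  proof
    assume "1 - ?z ^ d = 0"
    then have "fps_nth (1 - ?z ^ d) 0 = 0"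
      by simp
    then show False
      using root[of "u * v"] \<open>odd d\<close> unfolding fps_twist_power by (simp add: add.commute)
  qed
  \<comment> \<open>The exponent \<open>w * d\<close> is odd, so the sign inside \<open>?z\<close>
    survives and gives a plus.\<close>
  have E: "1 - ?z ^ (w * d) = ?E"
    using \<open>odd d\<close> \<open>odd w\<close> unfolding fps_twist_power
    by (simp add: power_mult[symmetric] fps_const_neg[symmetric] mult_ac del: fps_const_neg)
  have "2 * ?Q (w * d) * (1 - ?z ^ d) = 2 * ?Q d * (1 - ?z ^ (w * d))"
    using sum_periodic_power_series[where f = "\<lambda>a. fps_const (chi (int a))"
        and d = d and w = w and z = ?z] per
    by (simp add: mult.assoc)
  also have "\<dots> = G (u * v) * ?E * (1 - ?z ^ d)"
    unfolding G_def E euler_gf_scaled[OF root \<open>odd d\<close>, symmetric] by (simp only: mult_ac)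
  finally have Q: "2 * ?Q (w * d) = G (u * v) * ?E"
    by (rule mult_right_cancel[OF nz, THEN iffD1])
  have s: "fps_nth (fps_const c * fps_X) 0 = 0" for c :: 'a
    by simp
  \<comment> \<open>Rescaling turns both arguments \<open>u * y\<^sub>1\<close> and
    \<open>v * y\<^sub>2\<close> into multiples by the same symmetric
    \<open>u * v * w\<close>.\<close>
  have AB: "?A * ?B = fps_exp (of_nat (u * v * w) * (y\<^sub>1 + y\<^sub>2)) * (G (v * w) * G (u * w))"
    unfolding G_def fps_compose_mult_distrib[OF s] fps_exp_compose_linear
    by (simp only: of_nat_mult distrib_left fps_exp_add_mult mult_ac)
  show ?thesis
    unfolding S Q AB by (simp only: mult.assoc)
qed

theorem theorem2:
  fixes p d n w\<^sub>1 w\<^sub>2 w\<^sub>3 :: nat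
    and \<iota> :: "complex \<Rightarrow> 'a::{field_char_0, complete_space}"
    and chi :: "int \<Rightarrow> complex"
    and \<xi> y\<^sub>1 y\<^sub>2 :: 'a
  assumes "complex_padic_field TYPE('a) p" and "odd p"
    and "\<exists>s>0. \<xi> ^ (p ^ s) = 1"
    and "odd d"
    and "primitive_character d chi"
    and "algebraic_embedding \<iota>"
    and "odd w\<^sub>1" and "odd w\<^sub>2" and "odd w\<^sub>3"
    and "y\<^sub>1 \<in> padic_ints" and "y\<^sub>2 \<in> padic_ints"
  shows "let S = euler_power_sum d (\<lambda>a. \<iota> (chi a)) \<xi> y\<^sub>1 y\<^sub>2 n in
         S w\<^sub>1 w\<^sub>2 w\<^sub>3 = S w\<^sub>1 w\<^sub>3 w\<^sub>2 \<and>
         S w\<^sub>1 w\<^sub>3 w\<^sub>2 = S w\<^sub>2 w\<^sub>1 w\<^sub>3 \<and>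
         S w\<^sub>2 w\<^sub>1 w\<^sub>3 = S w\<^sub>2 w\<^sub>3 w\<^sub>1 \<and>
         S w\<^sub>2 w\<^sub>3 w\<^sub>1 = S w\<^sub>3 w\<^sub>2 w\<^sub>1 \<and>
         S w\<^sub>3 w\<^sub>2 w\<^sub>1 = S w\<^sub>3 w\<^sub>1 w\<^sub>2"
proof -
  obtain s where s: "\<xi> ^ (p ^ s) = 1"
    using assms by blast
  \<comment> \<open>Every power of \<open>\<xi>\<close> is again a root of unity of order dividing
    \<open>p ^ s\<close>.\<close>
  have root: "(\<xi> ^ m) ^ d + 1 \<noteq> 0" for m
    by (rule ramified_root_of_unity_power[OF _ \<open>odd p\<close> \<open>odd d\<close>, of _ s])
      (metis s power_mult mult.commute power_one)
  have per: "\<iota> (chi (a + int d)) = \<iota> (chi a)" for a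
    using assms(5) by (simp add: primitive_character_def dirichlet_character_def)
  let ?S = "euler_power_sum d (\<lambda>a. \<iota> (chi a)) \<xi> y\<^sub>1 y\<^sub>2 n"
  note gf = euler_power_sum_gf[where chi = "\<lambda>a. \<iota> (chi a)", OF root per \<open>odd d\<close>]
  have swap: "?S u v w = ?S v u w" if "odd w" for u v w
  proof -
    have "2 * ?S u v w = 2 * ?S v u w"
      unfolding gf[OF that] by (simp only: mult_ac)
    then show ?thesis by simp
  qed
  have rot: "?S u v w = ?S v w u" if "odd u" "odd w" for u v w
  proof -
    have "2 * ?S u v w = 2 * ?S v w u"
      unfolding gf[OF \<open>odd u\<close>] gf[OF \<open>odd w\<close>] by (simp only: mult_ac)
    then show ?thesis by simp
  qed
  \<comment> \<open>A transposition and a 3-cycle generate all permutations of the three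
    weights.\<close>
  show ?thesis
    unfolding Let_def using swap rot assms(7-9) by metis
qed

end
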